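(* Let $\nu>0$ and $x>0$. Then $$\sum_{n\ge1}\frac{1}{n^{\nu+1}}\big(I_\nu(nx)-\mathbf L_\nu(nx)\big)=\int_0^\infty J_\nu(xt)\left(\coth(\pi t)-\frac1{\pi t}\right)\frac{\mathrm dt}{t^{\nu+1}} .$$
   Context: $J_\nu(x)=\sum_{n\ge0}\frac{(-1)^n(x/2)^{2n+\nu}}{\Gamma(n+\nu+1)\,n!}$ is the Bessel function of the first kind, $I_\nu(x)=\sum_{n\ge0}\frac{(x/2)^{2n+\nu}}{\Gamma(n+\nu+1)\,n!}$ the modified Bessel function of the first kind, and $\mathbf L_\nu(x)=\sum_{n\ge0}\frac{(x/2)^{2n+\nu+1}}{\Gamma(n+\frac32)\Gamma(n+\nu+\frac32)}$ the modified Struve function. *)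

theory Defs
  imports "HOL-Analysis.Analysis"
begin

text \<open>
  The three functions below are meant for real order \<open>\<nu>\<close> and \<open>x > 0\<close>. Because of the
  convention \<open>0 powr a = 0\<close> the value at \<open>x = 0\<close> is wrong for \<open>\<nu> = 0\<close>, and for \<open>x < 0\<close>
  the real \<open>powr\<close> is not a power function. At the poles of \<open>Gamma\<close> the library's
  \<open>Gamma z = 0\<close> together with \<open>a / 0 = 0\<close> gives the usual convention \<open>1 / Gamma z = 0\<close>.
\<close>

definition bessel_J :: "real \<Rightarrow> real \<Rightarrow> real" where
  "bessel_J \<nu> x =
     (\<Sum>n. (-1) ^ n * (x / 2) powr (2 * real n + \<nu>) / (Gamma (real n + \<nu> + 1) * fact n))"

definition bessel_I :: "real \<Rightarrow> real \<Rightarrow> real" where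
  "bessel_I \<nu> x =
     (\<Sum>n. (x / 2) powr (2 * real n + \<nu>) / (Gamma (real n + \<nu> + 1) * fact n))"

text \<open>The modified Struve function.\<close>

definition struve_L :: "real \<Rightarrow> real \<Rightarrow> real" where
  "struve_L \<nu> x =
     (\<Sum>n. (x / 2) powr (2 * real n + \<nu> + 1) / (Gamma (real n + 3 / 2) * Gamma (real n + \<nu> + 3 / 2)))"

definition coth :: "real \<Rightarrow> real" where
  "coth x = cosh x / sinh x"

end

theory Submission
  imports Defs "HOL-Complex_Analysis.Complex_Analysis" "HOL-Real_Asymp.Real_Asymp"
begin

text \<open>
  Both sides are transforms of the finite measure \<open>\<mu>\<close> on \<open>(0,1)\<close> with density
  \<open>w powr (- 1/2) (1 - w) powr (\<nu> - 1/2)\<close>. By Legendre duplication its half-integer moments are the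
  coefficients of the three series, so that, up to the common factor
  \<open>(y/2) powr \<nu> / (sqrt \<pi> \<Gamma>(\<nu> + 1/2))\<close>, \<open>J\<^sub>\<nu>(y)\<close> is \<open>\<integral> cos (y sqrt w) d\<mu>\<close> and \<open>I\<^sub>\<nu>(y) - L\<^sub>\<nu>(y)\<close> is
  \<open>\<integral> exp (- y sqrt w) d\<mu>\<close>. Expanding \<open>coth (\<pi> t) - 1/(\<pi> t)\<close> in partial fractions
  \<open>(2 t/\<pi>) / (t\<^sup>2 + n\<^sup>2)\<close>, the \<open>n\<close>-th term of the series arises by Fubini from
  \<open>\<integral> cos (b t) / (t\<^sup>2 + n\<^sup>2) dt = \<pi>/(2 n) exp (- n b)\<close> over the half line. Summation and integration
  may be exchanged because \<open>\<integral> cos (y sqrt w) d\<mu> = O(1 / sqrt y)\<close> for \<open>\<nu> > 0\<close>, which bounds the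
  \<open>n\<close>-th integral by a multiple of \<open>n powr (-3/2)\<close>.
\<close>

section \<open>Partial fractions of the hyperbolic cotangent\<close>

text \<open>Logarithmic derivative of Euler's reflection formula:
  \<open>Gamma w * Gamma (1 - w)\<close> is differentiated once by the product rule and once as
  \<open>pi / sin (pi * w)\<close>, and the nonzero common factor is cancelled.\<close>

lemma Digamma_reflection_complex:
  fixes z :: complex
  assumes "z \<notin> \<int>"
  shows "Digamma (1 - z) - Digamma z = of_real pi * cot (of_real pi * z)"
proof -
  have z: "z \<notin> \<int>\<^sub>\<le>\<^sub>0" "1 - z \<notin> \<int>\<^sub>\<le>\<^sub>0"
    using assms by (auto elim!: nonpos_Ints_cases simp: algebra_simps)
      (metis Ints_1 Ints_diff Ints_of_int add_diff_cancel_left' diff_add_cancel)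
  have s: "sin (of_real pi * z) \<noteq> 0"
    using assms by (auto simp: sin_eq_0 elim!: Ints_cases)
  let ?G = "\<lambda>w. Gamma w * Gamma (1 - w) :: complex"
  have "(?G has_field_derivative
          Gamma z * Gamma (1 - z) * (Digamma z - Digamma (1 - z))) (at z)"
    using z by (auto intro!: derivative_eq_intros simp: algebra_simps)
  moreover have "(?G has_field_derivative
          (- (of_real pi ^ 2 * cos (of_real pi * z) / (sin (of_real pi * z))\<^sup>2))) (at z)"
    unfolding Gamma_reflection_complex
    using s by (auto intro!: derivative_eq_intros simp: power2_eq_square field_simps)
  ultimately have "Gamma z * Gamma (1 - z) * (Digamma z - Digamma (1 - z)) =
      - (of_real pi ^ 2 * cos (of_real pi * z) / (sin (of_real pi * z))\<^sup>2)"
    by (rule DERIV_unique)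
  hence "of_real pi / sin (of_real pi * z) * (Digamma z - Digamma (1 - z)) =
      of_real pi / sin (of_real pi * z) * (- (of_real pi * cot (of_real pi * z)))"
    unfolding Gamma_reflection_complex by (simp add: cot_def power2_eq_square)
  hence "Digamma z - Digamma (1 - z) = - (of_real pi * cot (of_real pi * z))"
    using s by (subst (asm) mult_left_cancel) auto
  thus ?thesis by (metis minus_diff_eq minus_minus)
qed

text \<open>At \<open>z = \<i> * t\<close> the cotangent of the reflection formula becomes a
  hyperbolic cotangent, and the series of the two Digamma values pair the conjugate poles into real
  terms.\<close>

lemma coth_partial_fractions:
  fixes t :: real
  assumes "t > 0"
  shows "(\<lambda>k. 2 * t / pi * (1 / (t\<^sup>2 + (real (Suc k))\<^sup>2))) sums (coth (pi * t) - 1 / (pi * t))"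
proof -
  define z where "z = \<i> * complex_of_real t"
  have z: "z \<notin> \<int>"
    using assms by (auto elim!: Ints_cases simp: z_def complex_eq_iff)
  have nz: "z \<noteq> 0" using z by auto
  have D: "(\<lambda>k. inverse (of_nat (Suc k)) - inverse (w + of_nat k)) sums (Digamma w + euler_mascheroni)"
    if "w \<noteq> 0" for w :: complex
    using summable_sums[OF summable_Digamma[OF that]] by (simp add: Digamma_def)
  have "1 + z \<noteq> 0" "1 - z \<noteq> 0" using assms by (auto simp: z_def complex_eq_iff)
  \<comment> \<open>The harmonic terms and Euler's constant cancel in the difference.\<close>
  from sums_diff[OF D[OF this(2)] D[OF this(1)]]
  have "(\<lambda>k. inverse (1 + z + of_nat k) - inverse (1 - z + of_nat k))
     sums (Digamma (1 - z) - Digamma (1 + z))" by simp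
  \<comment> \<open>Shifting \<open>Digamma (1 + z)\<close> down to \<open>Digamma z\<close>
    produces the \<open>1 / z\<close>, which ends up as the subtracted
    \<open>1 / (pi * t)\<close>.\<close>
  also have "Digamma (1 - z) - Digamma (1 + z) = of_real pi * cot (of_real pi * z) - 1 / z"
    using Digamma_reflection_complex[OF z] Digamma_plus1[OF nz] by (simp add: add.commute)
  also have "(\<lambda>k. inverse (1 + z + of_nat k) - inverse (1 - z + of_nat k))
      = (\<lambda>k. - \<i> * of_real (2 * t / (t\<^sup>2 + (real (Suc k))\<^sup>2)))"
  proof
    fix k
    have nz: "1 + z + of_nat k \<noteq> 0" "1 - z + of_nat k \<noteq> 0"
      using assms by (auto simp: z_def complex_eq_iff)
    have eq: "(1 + z + of_nat k) * (1 - z + of_nat k) = of_real (t\<^sup>2 + (real (Suc k))\<^sup>2)"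
      by (simp add: z_def complex_eq_iff power2_eq_square algebra_simps)
    have "inverse (1 + z + of_nat k) - inverse (1 - z + of_nat k)
        = - 2 * z / ((1 + z + of_nat k) * (1 - z + of_nat k))"
      using nz by (simp add: divide_simps)
    thus "inverse (1 + z + of_nat k) - inverse (1 - z + of_nat k)
        = - \<i> * of_real (2 * t / (t\<^sup>2 + (real (Suc k))\<^sup>2))"
      unfolding eq by (simp add: z_def)
  qed
  also have "of_real pi * cot (of_real pi * z) - 1 / z = - \<i> * of_real (pi * coth (pi * t) - 1 / t)"
  proof -
    have cs: "cosh (of_real r :: complex) = of_real (cosh r)" "sinh (of_real r :: complex) = of_real (sinh r)" for r
      by (simp_all add: cosh_def sinh_def scaleR_conv_of_real exp_of_real flip: of_real_minus)
    have pz: "of_real pi * z = \<i> * of_real (pi * t)" by (simp add: z_def)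
    have c: "cos (of_real pi * z) = of_real (cosh (pi * t))"
      unfolding pz cosh_conv_cos[symmetric] by (rule cs)
    have "\<i> * sinh (of_real (pi * t) :: complex) = sin (\<i> * of_real (pi * t))"
      unfolding sinh_conv_sin by (simp flip: mult.assoc)
    hence s: "sin (of_real pi * z) = \<i> * of_real (sinh (pi * t))"
      unfolding pz cs by simp
    show ?thesis using assms unfolding cot_def c s coth_def
      by (simp add: z_def field_simps)
  qed
  finally have "(\<lambda>k. complex_of_real (2 * t / (t\<^sup>2 + (real (Suc k))\<^sup>2)))
      sums of_real (pi * coth (pi * t) - 1 / t)"
    by (subst (asm) sums_mult_iff) auto
  hence "(\<lambda>k. 2 * t / (t\<^sup>2 + (real (Suc k))\<^sup>2)) sums (pi * coth (pi * t) - 1 / t)"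
    by (simp only: sums_of_real_iff)
  from sums_divide[OF this, of pi] assms show ?thesis
    by (simp add: diff_divide_distrib mult.commute)
qed

section \<open>The Fourier cosine transform of the Cauchy density\<close>

text \<open>The term \<open>exp (- b)\<close> makes the singularity at the imaginary unit removable, so that Cauchy's
  theorem on a convex set suffices and no winding number is needed.\<close>

lemma half_disc_integral_bound:
  fixes b R :: real
  assumes b: "b \<ge> 0" and R: "R > 1"
  shows "norm (integral {-R..R} (\<lambda>s. (exp (\<i> * of_real (b * s)) - exp (- of_real b)) / of_real (1 + s\<^sup>2)))
           \<le> 2 / (R\<^sup>2 - 1) * R * pi"
proof -
  define N where "N = (\<lambda>z::complex. exp (\<i> * of_real b * z) - exp (- of_real b))"
  \<comment> \<open>Since \<open>1 + z^2 = (z - \<i>) * (z + \<i>)\<close> and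
    \<open>N \<i> = 0\<close>, the value at \<open>\<i>\<close> is the limit of the quotient;
    \<open>h\<close> is the holomorphic difference quotient \<open>q\<close> divided by
    \<open>z + \<i>\<close>.\<close>
  define h where "h = (\<lambda>z::complex. if z = \<i> then deriv N \<i> / (2 * \<i>) else N z / (1 + z\<^sup>2))"
  \<comment> \<open>This half-plane contains the closed upper half disc and avoids the other zero
    \<open>-\<i>\<close> of the denominator.\<close>
  define H where "H = {z. Im z > -1}"
  define q where "q = (\<lambda>z. if z = \<i> then deriv N \<i> else (N z - N \<i>) / (z - \<i>))"
  have N: "N holomorphic_on H" unfolding N_def by (intro holomorphic_intros)
  have oH: "open H" unfolding H_def by (rule open_halfspace_Im_gt)
  have "convex H" unfolding H_def by (rule convex_halfspace_Im_gt)
  have q: "q holomorphic_on H" unfolding q_def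
    by (rule pole_lemma_open[OF N oH])
  have "\<i> * of_real b * \<i> = - of_real b" by (simp add: complex_eq_iff)
  hence Ni: "N \<i> = 0" unfolding N_def by (simp only: diff_self)
  have ni: "z + \<i> \<noteq> 0" if "z \<in> H" for z using that by (auto simp: H_def complex_eq_iff)
  have "(\<lambda>z. q z / (z + \<i>)) holomorphic_on H"
    using ni by (intro holomorphic_intros q) auto
  also have "?this \<longleftrightarrow> h holomorphic_on H"
  proof (rule holomorphic_cong[OF refl])
    fix z assume z: "z \<in> H"
    have "(z - \<i>) * (z + \<i>) = 1 + z\<^sup>2" by (simp add: power2_eq_square algebra_simps)
    thus "q z / (z + \<i>) = h z"
      unfolding q_def h_def Ni by (cases "z = \<i>") (simp_all only: simp_thms if_True if_False diff_zero divide_divide_eq_left mult_2)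
  qed
  finally have h: "h holomorphic_on H" .
  define g where "g = part_circlepath 0 R 0 pi +++ linepath (complex_of_real (-R)) (of_real R)"
  have fin: "pathfinish (part_circlepath 0 R 0 pi) = complex_of_real (-R)"
       "pathstart (part_circlepath 0 R 0 pi) = complex_of_real R" by simp_all
  have pa: "path_image (part_circlepath 0 R 0 pi) \<subseteq> H \<inter> {z. Im z \<ge> 0 \<and> norm z = R}"
  proof
    fix z assume "z \<in> path_image (part_circlepath 0 R 0 pi)"
    then obtain x where x: "0 \<le> x" "x \<le> pi" "z = of_real R * exp (\<i> * of_real x)"
      by (auto simp: path_image_part_circlepath)
    have "Im z = R * sin x" unfolding x(3) by (simp add: Im_exp)
    moreover have "norm z = R" unfolding x(3) norm_mult using R by simp
    ultimately show "z \<in> H \<inter> {z. Im z \<ge> 0 \<and> norm z = R}"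
      using R mult_nonneg_nonneg[OF _ sin_ge_zero[OF x(1,2)], of R] by (simp add: H_def)
  qed
  have pl: "path_image (linepath (complex_of_real (-R)) (of_real R)) \<subseteq> H"
    by (auto simp: H_def closed_segment_def)
  have "(h has_contour_integral 0) g"
    using pa pl fin
    by (intro Cauchy_theorem_convex_simple[OF h \<open>convex H\<close>]) (auto simp: g_def path_image_join)
  moreover have int: "h contour_integrable_on part_circlepath 0 R 0 pi"
    "h contour_integrable_on linepath (complex_of_real (-R)) (of_real R)"
  proof -
    note c = continuous_on_subset[OF holomorphic_on_imp_continuous_on[OF h]]
    show "h contour_integrable_on part_circlepath 0 R 0 pi"
      by (rule contour_integrable_continuous_part_circlepath, rule c) (use pa in blast)
    show "h contour_integrable_on linepath (complex_of_real (-R)) (of_real R)"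
      by (rule contour_integrable_continuous_linepath, rule c) (use pl in simp)
  qed
  ultimately have eq: "contour_integral (part_circlepath 0 R 0 pi) h
      + contour_integral (linepath (complex_of_real (-R)) (of_real R)) h = 0"
    using contour_integral_join[OF int] contour_integral_unique[of h 0 g] unfolding g_def by simp
  have "norm (contour_integral (part_circlepath 0 R 0 pi) h) \<le> 2 / (R\<^sup>2 - 1) * R * (pi - 0)"
  proof (rule has_contour_integral_bound_part_circlepath[OF has_contour_integral_integral[OF int(1)]])
    fix z assume "z \<in> path_image (part_circlepath 0 R 0 pi)"
    hence z: "Im z \<ge> 0" "norm z = R" using pa by auto
    \<comment> \<open>On the upper half-plane \<open>exp (\<i> * b * z)\<close> has modulus
      \<open>exp (- b * Im z)\<close>, at most 1 because \<open>b\<close> is nonnegative.\<close>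
    have "norm (N z) \<le> 1 + 1" unfolding N_def using b z
      by (intro order_trans[OF norm_triangle_ineq4] add_mono) auto
    moreover have "R\<^sup>2 - 1 \<le> norm (1 + z\<^sup>2)"
      using norm_diff_ineq[of "z\<^sup>2" 1] z by (simp add: norm_power add.commute)
    moreover have "R\<^sup>2 > 1" using R by simp
    moreover have "z \<noteq> \<i>" using z R by auto
    ultimately show "norm (h z) \<le> 2 / (R\<^sup>2 - 1)"
      by (simp add: h_def norm_divide frac_le)
  qed (use R in auto)
  moreover have "contour_integral (linepath (complex_of_real (-R)) (of_real R)) h
      = integral {-R..R} (\<lambda>s. h (of_real s))"
    using R by (subst contour_integral_linepath_Reals_eq) auto
  moreover have "integral {-R..R} (\<lambda>s. h (of_real s)) =
    integral {-R..R} (\<lambda>s. (exp (\<i> * of_real (b * s)) - exp (- of_real b)) / of_real (1 + s\<^sup>2))"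
    by (intro integral_cong) (auto simp: h_def N_def complex_eq_iff[of _ \<i>] mult.assoc)
  moreover have "norm (contour_integral (linepath (complex_of_real (-R)) (of_real R)) h) =
      norm (contour_integral (part_circlepath 0 R 0 pi) h)"
    using eq by (simp add: add_eq_0_iff)
  ultimately show ?thesis by simp
qed

section \<open>From the contour bound to integrals over the half line\<close>

lemma inverse_one_plus_square_half_line:
  "has_bochner_integral lborel (\<lambda>s::real. indicator {0<..} s * (1 / (1 + s\<^sup>2))) (pi / 2)"
proof -
  have "(\<integral>\<^sup>+s. ennreal (1 / (1 + s\<^sup>2)) * indicator {0..} s \<partial>lborel) = ennreal (pi / 2 - arctan 0)"
    by (rule nn_integral_FTC_atLeast)
      (auto intro!: derivative_eq_intros tendsto_arctan_at_top simp: add_nonneg_eq_0_iff inverse_eq_divide)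
  also have "(\<integral>\<^sup>+s. ennreal (1 / (1 + s\<^sup>2)) * indicator {0..} s \<partial>lborel)
      = (\<integral>\<^sup>+s. ennreal (indicator {0<..} s * (1 / (1 + s\<^sup>2))) \<partial>lborel)"
    using AE_lborel_singleton[of "0::real"]
    by (intro nn_integral_cong_AE) (auto elim!: eventually_mono split: split_indicator)
  finally show ?thesis
    by (intro has_bochner_integral_nn_integral) (auto simp: split: split_indicator)
qed

text \<open>The half-disc bound tends to 0 as \<open>R\<close> grows, so the integral of
  \<open>P\<close>, the integrand with \<open>exp (- b)\<close> subtracted from the cosine,
  vanishes. The value is therefore \<open>exp (- b)\<close> times the arctangent integral
  \<open>pi / 2\<close>.\<close>

lemma cos_over_one_plus_square_half_line:
  fixes b :: real
  assumes b: "b \<ge> 0"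
  shows "has_bochner_integral lborel (\<lambda>s. indicator {0<..} s * (cos (b * s) / (1 + s\<^sup>2)))
           (pi / 2 * exp (- b))"
proof -
  define P where "P = (\<lambda>s::real. (cos (b * s) - exp (- b)) / (1 + s\<^sup>2))"
  define f where "f = (\<lambda>s. indicator {0<..} s * P s)"
  have pos: "1 + s\<^sup>2 > 0" for s :: real by (simp add: add_pos_nonneg)
  have [measurable]: "P \<in> borel_measurable borel" unfolding P_def by measurable
  have int1: "integrable lborel (\<lambda>s::real. indicator {0<..} s * (1 / (1 + s\<^sup>2)))"
    using inverse_one_plus_square_half_line by (rule integrable.intros)
  have f: "integrable lborel f"
  proof (rule Bochner_Integration.integrable_bound)
    show "integrable lborel (\<lambda>s::real. 2 * (indicator {0<..} s * (1 / (1 + s\<^sup>2))))"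
      by (rule integrable_mult_right[OF int1])
    have "\<bar>cos (b * s) - exp (- b)\<bar> \<le> 2" for s
      using abs_cos_le_one[of "b * s"] b by (smt (verit) exp_le_one_iff exp_gt_zero)
    thus "AE s in lborel. norm (f s) \<le> norm (2 * (indicator {0<..} s * (1 / (1 + s\<^sup>2))))"
      using pos by (auto simp: f_def P_def abs_mult divide_right_mono split: split_indicator)
  qed (simp add: f_def)
  have cont: "continuous_on S P" for S
    unfolding P_def using pos by (intro continuous_intros) (simp add: less_imp_neq[symmetric])
  \<comment> \<open>\<open>P\<close> is even, so the half-line truncation is half of the symmetric
    integral that the contour controls.\<close>
  have half: "(\<integral>s. indicator {..R} s *\<^sub>R f s \<partial>lborel) = integral {-R..R} P / 2" if "R > 0" for R
  proof -
    have "integral {-R..R} P = integral {-R..0} P + integral {0..R} P"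
      using that cont by (subst Henstock_Kurzweil_Integration.integral_combine) (auto intro: integrable_continuous_interval)
    also have "integral {-R..0} P = integral {0..R} (\<lambda>s. P (- s))"
      using Henstock_Kurzweil_Integration.integral_reflect_real[of R 0 "\<lambda>s. P (- s)"] by simp
    also have "(\<lambda>s. P (- s)) = P" by (simp add: P_def fun_eq_iff)
    finally have "integral {-R..R} P / 2 = integral {0..R} P" by simp
    also have "\<dots> = (LINT s:{0..R}|lborel. P s)"
      using borel_integrable_atLeastAtMost'[OF cont] by (rule set_borel_integral_eq_integral(2)[symmetric])
    also have "\<dots> = (\<integral>s. indicator {..R} s *\<^sub>R f s \<partial>lborel)"
      unfolding set_lebesgue_integral_def f_def
      using AE_lborel_singleton[of "0::real"]
      by (intro integral_cong_AE) (auto elim!: eventually_mono split: split_indicator)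
    finally show ?thesis ..
  qed
  have bound: "\<bar>integral {-R..R} P\<bar> \<le> 2 / (R\<^sup>2 - 1) * R * pi" if R: "R > 1" for R
  proof -
    let ?Q = "\<lambda>s. (exp (\<i> * of_real (b * s)) - exp (- of_real b)) / complex_of_real (1 + s\<^sup>2)"
    have ne: "complex_of_real (1 + s\<^sup>2) \<noteq> 0" for s using pos[of s] by (simp only: of_real_eq_0_iff)
    have "?Q integrable_on {-R..R}"
      by (intro integrable_continuous_interval continuous_intros ballI ne)
    hence "Re (integral {-R..R} ?Q) = integral {-R..R} (\<lambda>s. Re (?Q s))"
      using integral_linear[OF _ bounded_linear_Re, of ?Q] by (simp add: o_def)
    also have "(\<lambda>s. Re (?Q s)) = P"
      unfolding P_def Re_divide_of_real by (simp add: Re_exp)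
    finally have "integral {-R..R} P = Re (integral {-R..R} ?Q)" ..
    thus ?thesis
      using half_disc_integral_bound[OF b R] order_trans[OF abs_Re_le_cmod] by (simp only:)
  qed
  have "((\<lambda>R. integral {-R..R} P / 2) \<longlongrightarrow> 0) at_top"
  proof (rule Lim_null_comparison)
    show "\<forall>\<^sub>F R in at_top. norm (integral {-R..R} P / 2) \<le> 2 / (R\<^sup>2 - 1) * R * pi"
      using eventually_gt_at_top[of 1]
    proof eventually_elim
      case (elim R)
      show ?case by (rule order_trans[OF _ bound[OF elim]]) simp
    qed
    show "((\<lambda>R::real. 2 / (R\<^sup>2 - 1) * R * pi) \<longlongrightarrow> 0) at_top" by real_asymp
  qed
  moreover have "((\<lambda>R. integral {-R..R} P / 2) \<longlongrightarrow> integral\<^sup>L lborel f) at_top"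
  proof (rule Lim_transform_eventually)
    show "((\<lambda>R. \<integral>s. indicator {..R} s *\<^sub>R f s \<partial>lborel) \<longlongrightarrow> integral\<^sup>L lborel f) at_top"
      by (rule tendsto_integral_at_top[OF _ f]) simp
    show "\<forall>\<^sub>F R in at_top. (\<integral>s. indicator {..R} s *\<^sub>R f s \<partial>lborel) = integral {-R..R} P / 2"
      using eventually_gt_at_top[of 0] by eventually_elim (rule half)
  qed
  ultimately have "integral\<^sup>L lborel f = 0" by (intro tendsto_unique[OF trivial_limit_at_top_linorder])
  hence "has_bochner_integral lborel f 0" using f by (simp add: has_bochner_integral_iff)
  from has_bochner_integral_add[OF this has_bochner_integral_mult_right[OF inverse_one_plus_square_half_line, of "exp (- b)"]]
  have "has_bochner_integral lborel (\<lambda>s. f s + exp (- b) * (indicator {0<..} s * (1 / (1 + s\<^sup>2)))) (pi / 2 * exp (- b))"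
    by (simp add: mult.commute)
  also have "(\<lambda>s. f s + exp (- b) * (indicator {0<..} s * (1 / (1 + s\<^sup>2)))) =
      (\<lambda>s. indicator {0<..} s * (cos (b * s) / (1 + s\<^sup>2)))"
    by (auto simp: f_def P_def diff_divide_distrib split: split_indicator)
  finally show ?thesis .
qed

text \<open>Substitution \<open>s = t / c\<close>. The numerator stays general because it serves
  both the cosine, for the exact value, and the power \<open>-1/2\<close>, for the norm
  estimate.\<close>

lemma scale_half_line_integral:
  fixes g :: "real \<Rightarrow> real"
  assumes "has_bochner_integral lborel (\<lambda>s. indicator {0<..} s * (g s / (1 + s\<^sup>2))) I" and c: "c > 0"
  shows "has_bochner_integral lborel (\<lambda>t. indicator {0<..} t * (g (t / c) / (t\<^sup>2 + c\<^sup>2))) (I / c)"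
proof -
  have "has_bochner_integral lborel
      (\<lambda>t. indicator {0<..} (0 + (1 / c) * t) * (g (0 + (1 / c) * t) / (1 + (0 + (1 / c) * t)\<^sup>2))) (c * I)"
    using assms by (subst (asm) lborel_has_bochner_integral_real_affine_iff[of "1 / c" _ _ 0]) auto
  from has_bochner_integral_mult_right[OF this, of "1 / c\<^sup>2"]
  have "has_bochner_integral lborel
      (\<lambda>t. 1 / c\<^sup>2 * (indicator {0<..} (t / c) * (g (t / c) / (1 + (t / c)\<^sup>2)))) (I / c)"
    using c by (simp add: power2_eq_square)
  also have "(\<lambda>t. 1 / c\<^sup>2 * (indicator {0<..} (t / c) * (g (t / c) / (1 + (t / c)\<^sup>2)))) =
      (\<lambda>t. indicator {0<..} t * (g (t / c) / (t\<^sup>2 + c\<^sup>2)))"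
  proof
    fix t
    have eq: "c\<^sup>2 * (1 + (t / c)\<^sup>2) = t\<^sup>2 + c\<^sup>2"
      using c by (simp add: field_simps power_divide)
    have ind: "indicator {0<..} (t / c) = (indicator {0<..} t :: real)"
      using c by (simp add: indicator_def zero_less_divide_iff)
    have "1 / c\<^sup>2 * (i * (G / d)) = i * (G / (c\<^sup>2 * d))" for i G d :: real by simp
    thus "1 / c\<^sup>2 * (indicator {0<..} (t / c) * (g (t / c) / (1 + (t / c)\<^sup>2))) =
        indicator {0<..} t * (g (t / c) / (t\<^sup>2 + c\<^sup>2))"
      unfolding ind by (simp only: eq)
  qed
  finally show ?thesis .
qed

section \<open>Integral representations\<close>

lemma Gamma_legendre_duplication_real:
  fixes z :: real
  assumes "z > 0"
  shows "Gamma z * Gamma (z + 1 / 2) = 2 powr (1 - 2 * z) * sqrt pi * Gamma (2 * z)"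
proof -
  have "complex_of_real z \<notin> \<int>\<^sub>\<le>\<^sub>0" "complex_of_real z + 1 / 2 \<notin> \<int>\<^sub>\<le>\<^sub>0"
    using assms by (auto elim!: nonpos_Ints_cases simp: complex_eq_iff)
  note dup = Gamma_legendre_duplication[OF this]
  have "Gamma (complex_of_real z + 1 / 2) = of_real (Gamma (z + 1 / 2))"
    using Gamma_complex_of_real[of "z + 1 / 2"] by simp
  moreover have "Gamma (2 * complex_of_real z) = of_real (Gamma (2 * z))"
    using Gamma_complex_of_real[of "2 * z"] by simp
  moreover have "exp ((1 - 2 * of_real z) * of_real (ln 2)) = complex_of_real (2 powr (1 - 2 * z))"
    by (simp add: powr_def flip: exp_of_real)
  ultimately have "complex_of_real (Gamma z * Gamma (z + 1 / 2)) =
      of_real (2 powr (1 - 2 * z) * sqrt pi * Gamma (2 * z))"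
    using dup by (simp only: Gamma_complex_of_real of_real_mult)
  thus ?thesis by (simp only: of_real_eq_iff)
qed

text \<open>Under \<open>w = u^2\<close> this becomes
  \<open>2 * (1 - u^2) powr (\<nu> - 1 / 2)\<close> on the unit interval, the weight of Poisson's
  integral for the Bessel function. In the variable \<open>w\<close> the moments are Beta values
  directly.\<close>

definition beta_weight :: "real \<Rightarrow> real \<Rightarrow> real" where
  "beta_weight \<nu> w = indicator {0<..<1} w * (w powr (- 1 / 2) * (1 - w) powr (\<nu> - 1 / 2))"

definition beta_measure :: "real \<Rightarrow> real measure" where
  "beta_measure \<nu> = density lborel (\<lambda>w. ennreal (beta_weight \<nu> w))"

lemma beta_weight_nonneg [simp]: "beta_weight \<nu> w \<ge> 0"
  by (simp add: beta_weight_def)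

lemma beta_weight_measurable [measurable]: "beta_weight \<nu> \<in> borel_measurable borel"
  unfolding beta_weight_def by measurable

lemma sets_beta_measure [simp, measurable_cong]: "sets (beta_measure \<nu>) = sets borel"
  by (simp add: beta_measure_def)

lemma space_beta_measure [simp]: "space (beta_measure \<nu>) = UNIV"
  by (simp add: beta_measure_def)

lemma integral_beta_measure:
  fixes f :: "real \<Rightarrow> real"
  assumes "f \<in> borel_measurable borel"
  shows "integral\<^sup>L (beta_measure \<nu>) f = (\<integral>w. beta_weight \<nu> w * f w \<partial>lborel)"
  unfolding beta_measure_def using assms by (subst integral_density) auto

text \<open>Multiplying the weight by \<open>sqrt w ^ m\<close> only raises the exponent of
  \<open>w\<close> to \<open>(m + 1) / 2 - 1\<close>, which leaves Euler's Beta integrand.\<close>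

lemma beta_measure_moment:
  fixes m :: nat
  assumes "\<nu> > - 1 / 2"
  shows "has_bochner_integral (beta_measure \<nu>) (\<lambda>w. sqrt w ^ m) (Beta ((real m + 1) / 2) (\<nu> + 1 / 2))"
proof -
  have pos: "(real m + 1) / 2 > 0" "\<nu> + 1 / 2 > 0" using assms by auto
  let ?f = "\<lambda>w. w powr ((real m + 1) / 2 - 1) * (1 - w) powr (\<nu> + 1 / 2 - 1)"
  have "set_integrable lborel {0..1} ?f" by (rule integrable_Beta[OF pos])
  moreover have "(LINT w:{0..1}|lborel. ?f w) = Beta ((real m + 1) / 2) (\<nu> + 1 / 2)"
    using set_borel_integral_eq_integral(2)[OF integrable_Beta[OF pos]]
      integral_unique[OF has_integral_Beta_real[OF pos]] by simp
  ultimately have "has_bochner_integral lborel (\<lambda>w. indicator {0..1} w *\<^sub>R ?f w) (Beta ((real m + 1) / 2) (\<nu> + 1 / 2))"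
    by (simp add: has_bochner_integral_iff set_integrable_def set_lebesgue_integral_def)
  also have "?this \<longleftrightarrow> has_bochner_integral lborel (\<lambda>w. beta_weight \<nu> w *\<^sub>R sqrt w ^ m)
      (Beta ((real m + 1) / 2) (\<nu> + 1 / 2))"
  proof (rule has_bochner_integral_cong_AE)
    \<comment> \<open>The Beta integral lives on the closed interval and the weight on the open one;
      the endpoints form a null set.\<close>
    show "AE w in lborel. indicator {0..1} w *\<^sub>R ?f w = beta_weight \<nu> w *\<^sub>R sqrt w ^ m"
      using AE_lborel_singleton[of "0::real"] AE_lborel_singleton[of "1::real"]
    proof eventually_elim
      case (elim w)
      show ?case
      proof (cases "0 < w \<and> w < 1")
        case True
        hence "sqrt w ^ m = w powr (m / 2)" by (simp add: powr_half_sqrt[symmetric] powr_realpow[symmetric] powr_powr)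
        hence "w powr (- 1 / 2) * sqrt w ^ m = w powr ((real m + 1) / 2 - 1)"
          by (simp add: add_divide_distrib flip: powr_add)
        moreover have "\<nu> + 1 / 2 - 1 = \<nu> - 1 / 2" by simp
        ultimately show ?thesis using True unfolding beta_weight_def by (simp add: mult_ac)
      next
        case False
        thus ?thesis using elim by (auto simp: beta_weight_def split: split_indicator)
      qed
    qed
  qed (measurable)
  finally show ?thesis unfolding beta_measure_def
    by (intro has_bochner_integral_density) auto
qed

lemma finite_beta_measure:
  assumes "\<nu> > - 1 / 2"
  shows "finite_measure (beta_measure \<nu>)"
proof -
  have "integrable (beta_measure \<nu>) (\<lambda>w. 1 :: real)"
    using beta_measure_moment[OF assms, of 0] by (auto intro: integrable.intros)
  thus ?thesis
    by (intro finite_measureI) (auto simp: integrable_iff_bounded)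
qed

lemma AE_beta_measure: "AE w in beta_measure \<nu>. 0 < w \<and> w < 1"
  unfolding beta_measure_def by (subst AE_density) (auto simp: beta_weight_def intro!: AE_I2 split: split_indicator)

text \<open>Duplication at \<open>(m + 1) / 2\<close> trades \<open>Gamma ((m + 1) / 2)\<close> and
  the factorial for \<open>Gamma (m / 2 + 1)\<close>. For even \<open>m\<close> this gives the
  Bessel denominators, for odd \<open>m\<close> the Struve ones.\<close>

lemma Beta_moment_over_fact:
  assumes "\<nu> > - 1 / 2"
  shows "Beta ((real m + 1) / 2) (\<nu> + 1 / 2) / fact m =
    sqrt pi * Gamma (\<nu> + 1 / 2) / (2 ^ m * Gamma (real m / 2 + 1) * Gamma (real m / 2 + \<nu> + 1))"
proof -
  have "2 powr (1 - 2 * ((real m + 1) / 2)) = (2 powr (- real m) :: real)" by (simp add: add_divide_distrib)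
  also have "\<dots> = 1 / 2 ^ m" by (simp add: powr_minus powr_realpow field_simps)
  finally have p: "2 powr (1 - 2 * ((real m + 1) / 2)) = 1 / 2 ^ m" .
  have "(real m + 1) / 2 + 1 / 2 = real m / 2 + 1" "2 * ((real m + 1) / 2) = 1 + real m"
    by (simp_all add: field_simps)
  with Gamma_legendre_duplication_real[of "(real m + 1) / 2"]
  have G: "Gamma ((real m + 1) / 2) * Gamma (real m / 2 + 1) = sqrt pi * fact m / 2 ^ m"
    using p Gamma_fact[of m, where ?'a = real] by (simp only:) simp
  have pos: "Gamma (real m / 2 + 1) > 0" "Gamma (real m / 2 + \<nu> + 1) > 0"
    using assms by (auto intro!: Gamma_real_pos add_nonneg_pos simp: add.assoc)
  from G have "Gamma ((real m + 1) / 2) = sqrt pi * fact m / 2 ^ m / Gamma (real m / 2 + 1)"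
    using pos(1) by (subst nonzero_eq_divide_eq) auto
  moreover have "(real m + 1) / 2 + (\<nu> + 1 / 2) = m / 2 + \<nu> + 1" by (simp add: field_simps)
  ultimately show ?thesis
    unfolding Beta_def by (simp only:) simp
qed

text \<open>Termwise integration of a power series against the measure. Almost everywhere
  \<open>sqrt w\<close> lies below 1, so the \<open>m\<close>-th term is at most
  \<open>\<bar>y\<bar> ^ m / fact m\<close>, and the measure is finite. The coefficients
  \<open>c\<close> allow cosine, \<open>cosh\<close> and \<open>sinh\<close> to be treated at
  once.\<close>

lemma sums_beta_transform:
  fixes c :: "nat \<Rightarrow> real" and F :: "real \<Rightarrow> real"
  assumes \<nu>: "\<nu> > - 1 / 2" and c: "\<And>m. \<bar>c m\<bar> \<le> 1"
    and F: "\<And>z. (\<lambda>m. c m * z ^ m / fact m) sums F z"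
  shows "(\<lambda>m. c m * (y / 2) ^ m / (Gamma (real m / 2 + 1) * Gamma (real m / 2 + \<nu> + 1))) sums
     ((\<integral>w. F (y * sqrt w) \<partial>beta_measure \<nu>) / (sqrt pi * Gamma (\<nu> + 1 / 2)))"
    (is "?s sums _")
proof -
  interpret finite_measure "beta_measure \<nu>" by (rule finite_beta_measure[OF \<nu>])
  let ?M = "beta_measure \<nu>"
  let ?f = "\<lambda>m w. c m * (y * sqrt w) ^ m / fact m"
  have f_eq: "?f m = (\<lambda>w. (c m * y ^ m / fact m) * sqrt w ^ m)" for m by (simp add: power_mult_distrib fun_eq_iff)
  have f: "has_bochner_integral ?M (?f m) (sqrt pi * Gamma (\<nu> + 1 / 2) * ?s m)" for m
  proof -
    have "(c m * y ^ m / fact m) * Beta ((real m + 1) / 2) (\<nu> + 1 / 2) =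
        c m * y ^ m * (Beta ((real m + 1) / 2) (\<nu> + 1 / 2) / fact m)" by simp
    also have "\<dots> = sqrt pi * Gamma (\<nu> + 1 / 2) * ?s m"
      unfolding Beta_moment_over_fact[OF \<nu>] by (simp add: power_divide mult_ac)
    finally show ?thesis unfolding f_eq
      using has_bochner_integral_mult_right[OF beta_measure_moment[OF \<nu>, of m], of "c m * y ^ m / fact m"]
      by (simp only:)
  qed
  have bound: "\<bar>?f m w\<bar> \<le> \<bar>y\<bar> ^ m / fact m" if "0 < w \<and> w < 1" for m w
  proof -
    have "\<bar>c m\<bar> * (\<bar>y\<bar> ^ m * sqrt w ^ m) \<le> 1 * (\<bar>y\<bar> ^ m * 1)"
      using that c by (intro mult_mono power_le_one mult_nonneg_nonneg) auto
    thus ?thesis using that by (simp add: abs_mult power_abs power_mult_distrib divide_right_mono)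
  qed
  have sm: "summable (\<lambda>m. \<bar>y\<bar> ^ m / fact m)"
    using summable_exp[of "\<bar>y\<bar>"] by (simp add: field_simps)
  have "(\<lambda>m. integral\<^sup>L ?M (?f m)) sums (\<integral>w. (\<Sum>m. ?f m w) \<partial>?M)"
  proof (rule sums_integral)
    show "integrable ?M (?f m)" for m using f by (rule integrable.intros)
    show "AE w in ?M. summable (\<lambda>m. norm (?f m w))"
      using AE_beta_measure
    proof eventually_elim
      case (elim w)
      show ?case by (rule summable_comparison_test'[OF sm, of 0]) (use bound[OF elim] in simp)
    qed
    show "summable (\<lambda>m. \<integral>w. norm (?f m w) \<partial>?M)"
    proof (rule summable_comparison_test'[OF summable_mult[OF sm, of "measure ?M UNIV"], of 0])
      fix m
      have "(\<integral>w. norm (?f m w) \<partial>?M) \<le> (\<integral>w. \<bar>y\<bar> ^ m / fact m \<partial>?M)"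
      proof (rule integral_mono_AE)
        show "integrable ?M (\<lambda>w. norm (?f m w))"
          using f by (intro integrable_norm integrable.intros)
        show "AE w in ?M. norm (?f m w) \<le> \<bar>y\<bar> ^ m / fact m"
          using AE_beta_measure by eventually_elim (use bound in simp)
      qed simp
      thus "norm (\<integral>w. norm (?f m w) \<partial>?M) \<le> measure ?M UNIV * (\<bar>y\<bar> ^ m / fact m)"
        by (simp add: mult.commute)
    qed
  qed
  also have "(\<lambda>m. integral\<^sup>L ?M (?f m)) = (\<lambda>m. sqrt pi * Gamma (\<nu> + 1 / 2) * ?s m)"
    using f by (simp add: has_bochner_integral_iff)
  also have "(\<lambda>w. (\<Sum>m. ?f m w)) = (\<lambda>w. F (y * sqrt w))"
    using F by (simp add: sums_iff)
  finally have "(\<lambda>m. sqrt pi * Gamma (\<nu> + 1 / 2) * ?s m / (sqrt pi * Gamma (\<nu> + 1 / 2)))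
      sums ((\<integral>w. F (y * sqrt w) \<partial>?M) / (sqrt pi * Gamma (\<nu> + 1 / 2)))" by (rule sums_divide)
  moreover have "Gamma (\<nu> + 1 / 2) > 0" using \<nu> by (intro Gamma_real_pos) simp
  ultimately show ?thesis by simp
qed

text \<open>Passes to the shape of the defining series: \<open>e\<close> lists indices that include
  every nonzero coefficient, and the factor \<open>(y / 2) powr \<nu>\<close> merges with the
  integer powers.\<close>

lemma sums_beta_transform_powr:
  fixes \<nu> y :: real and c :: "nat \<Rightarrow> real" and F :: "real \<Rightarrow> real" and e :: "nat \<Rightarrow> nat"
  assumes "\<nu> > - 1 / 2" and "\<And>m. \<bar>c m\<bar> \<le> 1"
    and "\<And>z. (\<lambda>m. c m * z ^ m / fact m) sums F z"
    and e: "strict_mono e" "\<And>m. m \<notin> range e \<Longrightarrow> c m = 0" and y: "y > 0"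
  shows "(\<lambda>n. c (e n) * (y / 2) powr (real (e n) + \<nu>) / (Gamma (real (e n) / 2 + 1) * Gamma (real (e n) / 2 + \<nu> + 1))) sums
     ((y / 2) powr \<nu> * (\<integral>w. F (y * sqrt w) \<partial>beta_measure \<nu>) / (sqrt pi * Gamma (\<nu> + 1 / 2)))"
proof -
  let ?s = "\<lambda>m. c m * (y / 2) ^ m / (Gamma (real m / 2 + 1) * Gamma (real m / 2 + \<nu> + 1))"
  have "?s sums ((\<integral>w. F (y * sqrt w) \<partial>beta_measure \<nu>) / (sqrt pi * Gamma (\<nu> + 1 / 2)))"
    using assms by (intro sums_beta_transform) auto
  hence "(\<lambda>n. ?s (e n)) sums ((\<integral>w. F (y * sqrt w) \<partial>beta_measure \<nu>) / (sqrt pi * Gamma (\<nu> + 1 / 2)))"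
    by (subst sums_mono_reindex[OF e(1)]) (auto simp: e(2))
  from sums_mult[OF this, of "(y / 2) powr \<nu>"] show ?thesis
    using y powr_realpow[of "y / 2"] by (simp add: powr_add mult_ac)
qed

text \<open>Poisson's integral: the cosine series meets only the even moments, whose coefficients
  are those of the Bessel series.\<close>

lemma bessel_J_conv_beta_integral:
  assumes \<nu>: "\<nu> > - 1 / 2" and y: "y > 0"
  shows "bessel_J \<nu> y =
    (y / 2) powr \<nu> * (\<integral>w. cos (y * sqrt w) \<partial>beta_measure \<nu>) / (sqrt pi * Gamma (\<nu> + 1 / 2))"
proof -
  \<comment> \<open>The factorial built into \<open>cos_coeff\<close> is undone, leaving
    coefficients 0, 1 and -1.\<close>
  let ?c = "\<lambda>m. cos_coeff m * fact m"
  have "(\<lambda>m. ?c m * z ^ m / fact m) sums cos z" for z :: real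
    using cos_converges[of z] by simp
  note F = this
  have "(\<lambda>n. ?c (2 * n) * (y / 2) powr (real (2 * n) + \<nu>) / (Gamma (real (2 * n) / 2 + 1) * Gamma (real (2 * n) / 2 + \<nu> + 1))) sums
     ((y / 2) powr \<nu> * (\<integral>w. cos (y * sqrt w) \<partial>beta_measure \<nu>) / (sqrt pi * Gamma (\<nu> + 1 / 2)))"
    by (rule sums_beta_transform_powr[where c = ?c and e = "\<lambda>n. 2 * n", OF \<nu> _ F _ _ y]) (auto simp: cos_coeff_def strict_mono_def elim!: evenE)
  moreover have "?c (2 * n) = (-1) ^ n" "Gamma (real (2 * n) / 2 + 1) = fact n" for n
    using Gamma_fact[of n, where ?'a = real] by (simp_all add: cos_coeff_def add.commute)
  ultimately show ?thesis by (simp add: bessel_J_def sums_iff mult.commute)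
qed

text \<open>\<open>cosh\<close> meets the even moments and yields the Bessel part,
  \<open>sinh\<close> the odd ones and yields the Struve part; their difference is the decaying
  exponential.\<close>

lemma bessel_I_minus_struve_L_conv_beta_integral:
  assumes \<nu>: "\<nu> > - 1 / 2" and y: "y > 0"
  shows "bessel_I \<nu> y - struve_L \<nu> y =
    (y / 2) powr \<nu> * (\<integral>w. exp (- (y * sqrt w)) \<partial>beta_measure \<nu>) / (sqrt pi * Gamma (\<nu> + 1 / 2))"
proof -
  interpret finite_measure "beta_measure \<nu>" by (rule finite_beta_measure[OF \<nu>])
  have "(\<lambda>m. (if even m then 1 else 0) * z ^ m / fact m) sums cosh z" for z :: real
    using cosh_converges[of z] by (rule sums_cong[THEN iffD1, rotated]) (simp add: field_simps)
  note F = this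
  have "(\<lambda>n. (if even (2 * n) then 1 else 0) * (y / 2) powr (real (2 * n) + \<nu>) / (Gamma (real (2 * n) / 2 + 1) * Gamma (real (2 * n) / 2 + \<nu> + 1))) sums
     ((y / 2) powr \<nu> * (\<integral>w. cosh (y * sqrt w) \<partial>beta_measure \<nu>) / (sqrt pi * Gamma (\<nu> + 1 / 2)))"
    by (rule sums_beta_transform_powr[where c = "\<lambda>m. if even m then 1 else 0" and e = "\<lambda>n. 2 * n", OF \<nu> _ F _ _ y]) (auto simp: strict_mono_def elim!: evenE)
  moreover have "Gamma (real (2 * n) / 2 + 1) = fact n" for n
    using Gamma_fact[of n, where ?'a = real] by (simp_all add: add.commute)
  ultimately have I: "bessel_I \<nu> y = (y / 2) powr \<nu> * (\<integral>w. cosh (y * sqrt w) \<partial>beta_measure \<nu>) / (sqrt pi * Gamma (\<nu> + 1 / 2))"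
    by (simp add: bessel_I_def sums_iff mult.commute)
  have odd_range: "(if odd m then 1 else 0) = (0 :: real)" if "m \<notin> range (\<lambda>n. 2 * n + 1)" for m :: nat
    using that by (metis oddE rangeI)
  have "(\<lambda>m. (if odd m then 1 else 0) * z ^ m / fact m) sums sinh z" for z :: real
    using sinh_converges[of z] by (rule sums_cong[THEN iffD1, rotated]) (simp add: field_simps)
  note F = this
  have "(\<lambda>n. (if odd (2 * n + 1) then 1 else 0) * (y / 2) powr (real (2 * n + 1) + \<nu>) / (Gamma (real (2 * n + 1) / 2 + 1) * Gamma (real (2 * n + 1) / 2 + \<nu> + 1))) sums
     ((y / 2) powr \<nu> * (\<integral>w. sinh (y * sqrt w) \<partial>beta_measure \<nu>) / (sqrt pi * Gamma (\<nu> + 1 / 2)))"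
    by (rule sums_beta_transform_powr[where c = "\<lambda>m. if odd m then 1 else 0" and e = "\<lambda>n. 2 * n + 1", OF \<nu> _ F _ odd_range y])
      (auto simp: strict_mono_def)
  \<comment> \<open>The odd index \<open>2 * n + 1\<close> is what shifts the Gamma arguments by one
    half, to the \<open>3 / 2\<close> of the Struve series.\<close>
  moreover have "real (2 * n + 1) + \<nu> = 2 * real n + \<nu> + 1" "real (2 * n + 1) / 2 + 1 = real n + 3 / 2"
      "real (2 * n + 1) / 2 + \<nu> + 1 = real n + \<nu> + 3 / 2" for n by (simp_all add: field_simps)
  ultimately have L: "struve_L \<nu> y = (y / 2) powr \<nu> * (\<integral>w. sinh (y * sqrt w) \<partial>beta_measure \<nu>) / (sqrt pi * Gamma (\<nu> + 1 / 2))"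
    unfolding struve_L_def by (simp only:) (simp add: sums_iff)
  \<comment> \<open>This bounds both exponentials by \<open>exp y\<close>, giving the integrability
    needed to subtract the two integrals.\<close>
  have le: "\<bar>y * sqrt w\<bar> \<le> y" if "0 < w \<and> w < 1" for w
    using that y by (simp add: abs_mult mult_left_le)
  have "integrable (beta_measure \<nu>) (\<lambda>w. cosh (y * sqrt w))" "integrable (beta_measure \<nu>) (\<lambda>w. sinh (y * sqrt w))"
  proof -
    have m: "(\<lambda>w. exp (k * (y * sqrt w))) \<in> borel_measurable (beta_measure \<nu>)" for k :: real by measurable
    have "integrable (beta_measure \<nu>) (\<lambda>w. exp (k * (y * sqrt w)))" if "\<bar>k\<bar> \<le> 1" for k
    proof (rule integrable_const_bound[OF _ m])
      show "AE w in beta_measure \<nu>. norm (exp (k * (y * sqrt w))) \<le> exp y"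
        using AE_beta_measure
      proof eventually_elim
        case (elim w)
        have "k * (y * sqrt w) \<le> \<bar>k\<bar> * \<bar>y * sqrt w\<bar>" by (metis abs_ge_self abs_mult)
        also have "\<dots> \<le> 1 * y" using that le[OF elim] by (intro mult_mono) auto
        finally show ?case by simp
      qed
    qed
    from this[of 1] this[of "-1"] show "integrable (beta_measure \<nu>) (\<lambda>w. cosh (y * sqrt w))"
      "integrable (beta_measure \<nu>) (\<lambda>w. sinh (y * sqrt w))"
      by (simp_all add: cosh_def sinh_def)
  qed
  hence "(\<integral>w. cosh (y * sqrt w) - sinh (y * sqrt w) \<partial>beta_measure \<nu>) =
      (\<integral>w. cosh (y * sqrt w) \<partial>beta_measure \<nu>) - (\<integral>w. sinh (y * sqrt w) \<partial>beta_measure \<nu>)"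
    by (rule Bochner_Integration.integral_diff)
  thus ?thesis
    unfolding I L by (simp add: cosh_minus_sinh diff_divide_distrib right_diff_distrib)
qed

section \<open>Decay of the cosine transform\<close>

text \<open>The antiderivative \<open>2 * sin (y * sqrt w) / y\<close> is continuous up to 0, so the
  singularity of the integrand there is harmless: only interior derivatives are required.\<close>

lemma has_integral_cos_sqrt:
  fixes y a b :: real
  assumes "y > 0" "0 \<le> a" "a \<le> b"
  shows "((\<lambda>w. w powr (- 1 / 2) * cos (y * sqrt w)) has_integral
           (2 * sin (y * sqrt b) / y - 2 * sin (y * sqrt a) / y)) {a..b}"
proof (rule fundamental_theorem_of_calculus_interior)
  show "continuous_on {a..b} (\<lambda>w. 2 * sin (y * sqrt w) / y)"
    using assms by (intro continuous_intros) auto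
  fix w assume "w \<in> {a<..<b}"
  hence w: "w > 0" using assms by simp
  have "((\<lambda>w. 2 * sin (y * sqrt w) / y) has_real_derivative
      2 * (cos (y * sqrt w) * (y * (inverse (sqrt w) / 2))) / y) (at w)"
    using w by (auto intro!: derivative_eq_intros)
  also have "2 * (cos (y * sqrt w) * (y * (inverse (sqrt w) / 2))) / y = w powr (- 1 / 2) * cos (y * sqrt w)"
    using w assms by (simp add: powr_minus powr_half_sqrt)
  finally show "((\<lambda>w. 2 * sin (y * sqrt w) / y) has_vector_derivative w powr (- 1 / 2) * cos (y * sqrt w)) (at w)"
    by (simp add: has_real_derivative_iff_has_vector_derivative)
qed (use assms in auto)

text \<open>The second mean value theorem turns the integral into \<open>g a\<close> and
  \<open>g b\<close> times integrals of \<open>f\<close> over two subintervals. A decreasing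
  \<open>g\<close> is handled through its negative.\<close>

lemma second_mean_value_bound:
  fixes f g :: "real \<Rightarrow> real"
  assumes ab: "a \<le> b" and f: "f integrable_on {a..b}" and g: "mono_on {a..b} g \<or> antimono_on {a..b} g"
    and B: "\<And>c d. a \<le> c \<Longrightarrow> c \<le> d \<Longrightarrow> d \<le> b \<Longrightarrow> \<bar>integral {c..d} f\<bar> \<le> B"
  shows "\<bar>integral {a..b} (\<lambda>x. g x * f x)\<bar> \<le> (\<bar>g a\<bar> + \<bar>g b\<bar>) * B"
proof -
  have *: "\<bar>integral {a..b} (\<lambda>x. h x * f x)\<bar> \<le> (\<bar>h a\<bar> + \<bar>h b\<bar>) * B" if h: "mono_on {a..b} h" for h
  proof -
    obtain c where c: "c \<in> {a..b}"
      "integral {a..b} (\<lambda>x. h x * f x) = h a * integral {a..c} f + h b * integral {c..b} f"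
      using second_mean_value_theorem[OF f ab, of h] h by (auto simp: mono_on_def)
    have "\<bar>h a * integral {a..c} f\<bar> \<le> \<bar>h a\<bar> * B" "\<bar>h b * integral {c..b} f\<bar> \<le> \<bar>h b\<bar> * B"
      unfolding abs_mult using c(1) by (auto intro!: mult_left_mono B)
    thus ?thesis unfolding c(2) by (simp add: distrib_right)
  qed
  show ?thesis
  proof (cases "mono_on {a..b} g")
    case False
    hence "mono_on {a..b} (\<lambda>x. - g x)" using g by (auto simp: monotone_on_def)
    from *[OF this] show ?thesis by simp
  qed (rule *)
qed

text \<open>Split at distance \<open>1 / y\<close> from 1. Up to there oscillation wins: integrals
  of \<open>f\<close> are at most \<open>4 / y\<close> and the endpoint values of \<open>g\<close>
  add up to at most \<open>2 * y powr (1 / 2)\<close>, giving the constant 8. The short rest, where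
  \<open>g\<close> may be singular, is estimated absolutely and gives 4.\<close>

lemma beta_integral_decay_ge_2:
  assumes \<nu>: "\<nu> > 0" and y: "y \<ge> 2"
  shows "\<bar>\<integral>w. cos (y * sqrt w) \<partial>beta_measure \<nu>\<bar> \<le> 12 * y powr (- 1 / 2)"
proof -
  define g where "g = (\<lambda>w. (1 - w) powr (\<nu> - 1 / 2))"
  define f where "f = (\<lambda>w. w powr (- 1 / 2) * cos (y * sqrt w))"
  \<comment> \<open>This distance makes both pieces of order \<open>y powr (- 1 / 2)\<close>;
    \<open>y \<ge> 2\<close> keeps \<open>b\<close> away from the singularity at 0.\<close>
  define b where "b = 1 - 1 / y"
  have b: "1 / 2 \<le> b" "0 \<le> b" "b \<le> 1" using y by (auto simp: b_def field_simps)
  interpret finite_measure "beta_measure \<nu>" using \<nu> by (intro finite_beta_measure) simp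
  \<comment> \<open>A larger exponent lowers a power with base at most 1. At \<open>w = 1\<close>
    both sides are 0 by the convention for \<open>powr\<close>.\<close>
  have g_le: "g w \<le> (1 - w) powr (- 1 / 2)" if "0 \<le> w" "w \<le> 1" for w
  proof (cases "w = 1")
    case False
    thus ?thesis unfolding g_def using that \<nu> by (intro powr_mono') auto
  qed (simp add: g_def)
  have f_int: "f integrable_on {c..d}" and f_bound: "\<bar>integral {c..d} f\<bar> \<le> 4 / y"
    if "0 \<le> c" "c \<le> d" for c d
  proof -
    have *: "(f has_integral (2 * sin (y * sqrt d) / y - 2 * sin (y * sqrt c) / y)) {c..d}"
      unfolding f_def using that y by (intro has_integral_cos_sqrt) auto
    thus "f integrable_on {c..d}" by blast
    have "\<bar>2 * sin (y * sqrt d) - 2 * sin (y * sqrt c)\<bar> \<le> 4"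
      using abs_sin_le_one[of "y * sqrt d"] abs_sin_le_one[of "y * sqrt c"] by linarith
    moreover have "integral {c..d} f = (2 * sin (y * sqrt d) - 2 * sin (y * sqrt c)) / y"
      using * by (simp add: integral_unique diff_divide_distrib)
    ultimately show "\<bar>integral {c..d} f\<bar> \<le> 4 / y"
      using y by (simp add: divide_right_mono)
  qed
  have lb: "integrable (beta_measure \<nu>) (\<lambda>w. cos (y * sqrt w))"
    by (rule integrable_const_bound[of _ 1]) auto
  hence "integrable lborel (\<lambda>w. beta_weight \<nu> w * cos (y * sqrt w))"
    unfolding beta_measure_def by (subst (asm) integrable_density) auto
  also have "?this \<longleftrightarrow> set_integrable lborel {0<..<1} (\<lambda>w. g w * f w)"
    unfolding set_integrable_def by (simp add: beta_weight_def g_def f_def mult_ac)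
  finally have si: "set_integrable lborel {0<..<1} (\<lambda>w. g w * f w)" .
  have "(\<integral>w. cos (y * sqrt w) \<partial>beta_measure \<nu>) = (LINT w:{0<..<1}|lborel. g w * f w)"
    unfolding set_lebesgue_integral_def
    by (subst integral_beta_measure) (simp_all add: beta_weight_def g_def f_def mult_ac)
  also have "\<dots> = integral {0<..<1} (\<lambda>w. g w * f w)"
    by (rule set_borel_integral_eq_integral(2)[OF si])
  also have "\<dots> = integral {0..1} (\<lambda>w. g w * f w)"
    using integral_open_interval[of "0::real" 1 "\<lambda>w. g w * f w"] by (simp add: box_real)
  finally have eq: "(\<integral>w. cos (y * sqrt w) \<partial>beta_measure \<nu>) = integral {0..1} (\<lambda>w. g w * f w)" .
  have int: "(\<lambda>w. g w * f w) integrable_on {0..1}"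
    using set_borel_integral_eq_integral(1)[OF si] integrable_on_open_interval[of "\<lambda>w. g w * f w" "0::real" 1] by (simp add: box_real)
  have y_half: "y powr (1 / 2) / y = y powr (- 1 / 2)"
    using y by (simp add: powr_minus powr_half_sqrt field_simps)
  have "g b \<le> y powr (1 / 2)"
    using g_le[of b] b y by (simp add: b_def powr_divide powr_minus field_simps)
  moreover have "1 \<le> y powr (1 / 2)" using y by (simp add: ge_one_powr_ge_zero)
  moreover have "g 0 = 1" "g b \<ge> 0" by (simp_all add: g_def)
  ultimately have "(\<bar>g 0\<bar> + \<bar>g b\<bar>) * (4 / y) \<le> (2 * y powr (1 / 2)) * (4 / y)"
    using y by (intro mult_right_mono) auto
  also have "\<dots> = 8 * y powr (- 1 / 2)" using y_half by simp
  finally have gb: "(\<bar>g 0\<bar> + \<bar>g b\<bar>) * (4 / y) \<le> 8 * y powr (- 1 / 2)" .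
  \<comment> \<open>The sign of \<open>\<nu> - 1 / 2\<close> decides the direction; in the
    increasing case \<open>b < 1\<close> excludes the singularity.\<close>
  have "mono_on {0..b} g \<or> antimono_on {0..b} g"
  proof (cases "\<nu> \<ge> 1 / 2")
    case True
    thus ?thesis using b by (auto simp: monotone_on_def g_def intro!: powr_mono2)
  next
    case False
    have "b < 1" using y by (simp add: b_def)
    thus ?thesis using False by (auto simp: monotone_on_def g_def intro!: powr_mono2')
  qed
  hence "\<bar>integral {0..b} (\<lambda>w. g w * f w)\<bar> \<le> (\<bar>g 0\<bar> + \<bar>g b\<bar>) * (4 / y)"
    using b by (intro second_mean_value_bound f_int f_bound) auto
  also note gb
  finally have main: "\<bar>integral {0..b} (\<lambda>w. g w * f w)\<bar> \<le> 8 * y powr (- 1 / 2)" .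
  have h: "((\<lambda>w. 2 * (1 - w) powr (- 1 / 2)) has_integral (- 4 * sqrt (1 - 1) - (- 4 * sqrt (1 - b)))) {b..1}"
  proof (rule fundamental_theorem_of_calculus_interior)
    fix w assume w: "w \<in> {b<..<1}"
    have "((\<lambda>w. - 4 * sqrt (1 - w)) has_real_derivative 2 * (1 - w) powr (- 1 / 2)) (at w)"
      using w by (auto intro!: derivative_eq_intros simp: powr_minus powr_half_sqrt field_simps)
    thus "((\<lambda>w. - 4 * sqrt (1 - w)) has_vector_derivative 2 * (1 - w) powr (- 1 / 2)) (at w)"
      by (simp add: has_real_derivative_iff_has_vector_derivative)
  qed (use b in \<open>auto intro!: continuous_intros\<close>)
  have "norm (integral {b..1} (\<lambda>w. g w * f w)) \<le> integral {b..1} (\<lambda>w. 2 * (1 - w) powr (- 1 / 2))"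
  proof (rule integral_norm_bound_integral)
    show "(\<lambda>w. g w * f w) integrable_on {b..1}"
      using int by (rule integrable_subinterval_real) (use b in auto)
    show "(\<lambda>w. 2 * (1 - w) powr (- 1 / 2)) integrable_on {b..1}" using h by blast
    fix w assume w: "w \<in> {b..1}"
    \<comment> \<open>\<open>1 / 4\<close> is a lower bound for \<open>w\<close> with a rational
      square root.\<close>
    have "w powr (- 1 / 2) \<le> (1 / 4) powr (- 1 / 2)" using w b by (intro powr_mono2') auto
    also have "(1 / 4 :: real) powr (- 1 / 2) = 2"
      by (simp add: powr_minus powr_half_sqrt real_sqrt_divide)
    finally have "w powr (- 1 / 2) * \<bar>cos (y * sqrt w)\<bar> \<le> 2 * 1" by (intro mult_mono) auto
    hence "\<bar>f w\<bar> \<le> 2" by (simp add: f_def abs_mult)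
    hence "g w * \<bar>f w\<bar> \<le> (1 - w) powr (- 1 / 2) * 2"
      using g_le[of w] w b by (intro mult_mono) (auto simp: g_def)
    thus "norm (g w * f w) \<le> 2 * (1 - w) powr (- 1 / 2)"
      by (simp add: abs_mult g_def)
  qed
  also have "\<dots> = 4 * y powr (- 1 / 2)"
    using integral_unique[OF h] y by (simp add: b_def powr_minus powr_half_sqrt real_sqrt_divide field_simps)
  finally have tail: "\<bar>integral {b..1} (\<lambda>w. g w * f w)\<bar> \<le> 4 * y powr (- 1 / 2)" by simp
  have "integral {0..1} (\<lambda>w. g w * f w) = integral {0..b} (\<lambda>w. g w * f w) + integral {b..1} (\<lambda>w. g w * f w)"
    using Henstock_Kurzweil_Integration.integral_combine[OF b(2,3) int] by simp
  thus ?thesis using main tail unfolding eq by linarith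
qed

lemma beta_integral_decay:
  assumes \<nu>: "\<nu> > 0"
  obtains C where "C \<ge> 0" "\<And>y. y > 0 \<Longrightarrow> \<bar>\<integral>w. cos (y * sqrt w) \<partial>beta_measure \<nu>\<bar> \<le> C * y powr (- 1 / 2)"
proof
  interpret finite_measure "beta_measure \<nu>" using \<nu> by (intro finite_beta_measure) simp
  let ?m = "measure (beta_measure \<nu>) UNIV"
  show "0 \<le> max 12 (2 * ?m)" by simp
  fix y :: real assume y: "y > 0"
  show "\<bar>\<integral>w. cos (y * sqrt w) \<partial>beta_measure \<nu>\<bar> \<le> max 12 (2 * ?m) * y powr (- 1 / 2)"
  proof (cases "y \<ge> 2")
    case True
    show ?thesis
      by (rule order_trans[OF beta_integral_decay_ge_2[OF \<nu> True]]) (intro mult_right_mono, auto)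
  next
    case False
    have "\<bar>\<integral>w. cos (y * sqrt w) \<partial>beta_measure \<nu>\<bar> \<le> (\<integral>w. \<bar>cos (y * sqrt w)\<bar> \<partial>beta_measure \<nu>)"
      by (rule integral_abs_bound)
    also have "\<dots> \<le> (\<integral>w. 1 \<partial>beta_measure \<nu>)"
      by (intro integral_mono integrable_const_bound[of _ 1]) auto
    \<comment> \<open>The total mass is rewritten as \<open>2 * ?m * 4 powr (- 1 / 2)\<close>, which
      can be compared with \<open>y powr (- 1 / 2)\<close> because
      \<open>y < 2 \<le> 4\<close>.\<close>
    also have "\<dots> = 2 * ?m * (1 / 4) powr (1 / 2)" by (simp add: powr_half_sqrt real_sqrt_divide)
    also have "(1 / 4 :: real) powr (1 / 2) = 4 powr (- 1 / 2)" by (simp add: powr_divide powr_minus field_simps)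
    also have "2 * ?m * 4 powr (- 1 / 2) \<le> max 12 (2 * ?m) * y powr (- 1 / 2)"
      using y False by (intro mult_mono powr_mono2') auto
    finally show ?thesis .
  qed
qed

section \<open>Exchanging sum and integral\<close>

text \<open>Below 1 the function is dominated by \<open>s powr (- 1 / 2)\<close>, above 1 by
  \<open>1 / (1 + s^2)\<close>.\<close>

lemma inverse_sqrt_over_one_plus_square_integrable:
  "integrable lborel (\<lambda>s::real. indicator {0<..} s * (s powr (- 1 / 2) / (1 + s\<^sup>2)))"
proof (rule Bochner_Integration.integrable_bound)
  \<comment> \<open>A Beta integrand with parameters \<open>1 / 2\<close> and 1. Its second factor
    is 1 below 1 but 0 at \<open>s = 1\<close>, so that point joins the case
    \<open>s \<ge> 1\<close>.\<close>
  let ?h = "\<lambda>s::real. s powr (1 / 2 - 1) * (1 - s) powr (1 - 1)"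
  show "integrable lborel (\<lambda>s. indicator {0..1} s *\<^sub>R ?h s + indicator {0<..} s * (1 / (1 + s\<^sup>2)))"
    using integrable_Beta[of "1 / 2" 1] integrable.intros[OF inverse_one_plus_square_half_line]
    by (intro Bochner_Integration.integrable_add) (auto simp: set_integrable_def)
  have le: "norm (indicator {0<..} s * (s powr (- 1 / 2) / (1 + s\<^sup>2)))
      \<le> indicator {0..1} s *\<^sub>R ?h s + indicator {0<..} s * (1 / (1 + s\<^sup>2))" for s :: real
  proof (cases "s \<le> 0 \<or> s \<ge> 1")
    case True
    moreover have "s powr (- 1 / 2) / (1 + s\<^sup>2) \<le> 1 / (1 + s\<^sup>2)" if "s \<ge> 1"
      using powr_mono2'[of "- 1 / 2" 1 s] that by (intro divide_right_mono) auto
    ultimately show ?thesis by (auto simp: indicator_def)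
  next
    case False
    hence "s powr (- 1 / 2) / (1 + s\<^sup>2) \<le> s powr (- 1 / 2) / 1"
      by (intro divide_left_mono) (auto intro: add_pos_nonneg)
    moreover have "0 \<le> 1 / (1 + s\<^sup>2)" by simp
    ultimately have "s powr (- 1 / 2) / (1 + s\<^sup>2) + 0 \<le> s powr (- 1 / 2) / 1 + 1 / (1 + s\<^sup>2)"
      by (rule add_mono)
    thus ?thesis using False by (simp add: indicator_def)
  qed
  show "AE s in lborel. norm (indicator {0<..} s * (s powr (- 1 / 2) / (1 + s\<^sup>2)))
      \<le> norm (indicator {0..1} s *\<^sub>R ?h s + indicator {0<..} s * (1 / (1 + s\<^sup>2)))"
    by (intro AE_I2 order_trans[OF le]) (simp only: real_norm_def abs_ge_self)
qed simp

section \<open>Fubini for a single partial fraction\<close>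

lemma cos_over_square_plus_square_half_line:
  fixes b c :: real
  assumes b: "b \<ge> 0" and c: "c > 0"
  shows "has_bochner_integral lborel (\<lambda>t. indicator {0<..} t * (cos (b * t) / (t\<^sup>2 + c\<^sup>2)))
           (pi / (2 * c) * exp (- (c * b)))"
  using scale_half_line_integral[OF cos_over_one_plus_square_half_line[of "c * b"] c] b c by simp

lemma beta_integral_cos_over_square_plus_square:
  fixes x c :: real
  assumes \<nu>: "\<nu> > - 1 / 2" and x: "x > 0" and c: "c > 0"
  shows "has_bochner_integral lborel
      (\<lambda>t. indicator {0<..} t * ((\<integral>w. cos (x * t * sqrt w) \<partial>beta_measure \<nu>) / (t\<^sup>2 + c\<^sup>2)))
      (pi / (2 * c) * (\<integral>w. exp (- (c * x * sqrt w)) \<partial>beta_measure \<nu>))"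
proof -
  let ?M = "beta_measure \<nu>"
  interpret M: finite_measure ?M by (rule finite_beta_measure[OF \<nu>])
  interpret P: pair_sigma_finite lborel ?M ..
  define h where "h = (\<lambda>t::real. indicator {0<..} t * (1 / (t\<^sup>2 + c\<^sup>2)))"
  have h: "integrable lborel h" unfolding h_def
    \<comment> \<open>Frequency 0 of the cosine integral. As cosine is bounded by 1,
      \<open>h\<close> times the total mass is the dominating function for Fubini.\<close>
    using integrable.intros[OF cos_over_square_plus_square_half_line[of 0, OF _ c]] by simp
  have h_nonneg: "h t \<ge> 0" for t by (simp add: h_def)
  have [measurable]: "h \<in> borel_measurable borel" unfolding h_def by measurable
  define f where "f = (\<lambda>t w. h t * cos (x * t * sqrt w))"
  have [measurable]: "(\<lambda>(t, w). f t w) \<in> borel_measurable (lborel \<Otimes>\<^sub>M ?M)"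
    unfolding f_def by measurable
  have fw: "integrable ?M (f t)" for t
    unfolding f_def by (intro integrable_mult_right M.integrable_const_bound[of _ 1]) auto
  have "integrable (lborel \<Otimes>\<^sub>M ?M) (\<lambda>(t, w). f t w)"
  proof (rule P.Fubini_integrable)
    show "integrable lborel (\<lambda>t. \<integral>w. norm ((\<lambda>(t, w). f t w) (t, w)) \<partial>?M)"
    proof (rule Bochner_Integration.integrable_bound)
      show "integrable lborel (\<lambda>t. h t * measure ?M UNIV)" using h by simp
      show "AE t in lborel. norm (\<integral>w. norm ((\<lambda>(t, w). f t w) (t, w)) \<partial>?M) \<le> norm (h t * measure ?M UNIV)"
      proof (intro AE_I2)
        fix t
        have "(\<integral>w. norm (f t w) \<partial>?M) \<le> (\<integral>w. h t \<partial>?M)"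
          using fw[of t] h_nonneg
          by (intro integral_mono integrable_norm) (auto simp: f_def abs_mult mult_left_le)
        thus "norm (\<integral>w. norm ((\<lambda>(t, w). f t w) (t, w)) \<partial>?M) \<le> norm (h t * measure ?M UNIV)"
          using h_nonneg[of t] by (simp add: abs_mult mult.commute)
      qed
    qed simp
    show "AE t in lborel. integrable ?M (\<lambda>w. (\<lambda>(t, w). f t w) (t, w))" using fw by simp
  qed simp
  note int = this
  have "(\<integral>w. (\<integral>t. f t w \<partial>lborel) \<partial>?M) = (\<integral>w. pi / (2 * c) * exp (- (c * x * sqrt w)) \<partial>?M)"
  proof (rule integral_cong_AE)
    show "AE w in ?M. (\<integral>t. f t w \<partial>lborel) = pi / (2 * c) * exp (- (c * x * sqrt w))"
      using AE_beta_measure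
    proof eventually_elim
      case (elim w)
      have "has_bochner_integral lborel (\<lambda>t. indicator {0<..} t * (cos (x * sqrt w * t) / (t\<^sup>2 + c\<^sup>2)))
           (pi / (2 * c) * exp (- (c * (x * sqrt w))))"
        using x elim by (intro cos_over_square_plus_square_half_line c) simp
      moreover have "(\<lambda>t. indicator {0<..} t * (cos (x * sqrt w * t) / (t\<^sup>2 + c\<^sup>2))) = (\<lambda>t. f t w)"
        by (simp add: f_def h_def mult_ac)
      ultimately show ?case by (simp add: has_bochner_integral_iff mult.assoc)
    qed
  qed measurable
  hence "(\<integral>t. (\<integral>w. f t w \<partial>?M) \<partial>lborel) = pi / (2 * c) * (\<integral>w. exp (- (c * x * sqrt w)) \<partial>?M)"
    using P.Fubini_integral[OF int] by simp
  moreover have "integrable lborel (\<lambda>t. \<integral>w. f t w \<partial>?M)"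
    using P.integrable_fst'[OF int] by simp
  moreover have "(\<lambda>t. \<integral>w. f t w \<partial>?M) =
      (\<lambda>t. indicator {0<..} t * ((\<integral>w. cos (x * t * sqrt w) \<partial>?M) / (t\<^sup>2 + c\<^sup>2)))"
    by (simp add: f_def h_def)
  ultimately show ?thesis by (simp add: has_bochner_integral_iff)
qed

section \<open>Termwise integration of the partial fraction series\<close>

theorem theorem12:
  fixes \<nu> x :: real
  assumes "\<nu> > 0" and "x > 0"
  shows "set_integrable lborel {0<..}
           (\<lambda>t. bessel_J \<nu> (x * t) * (coth (pi * t) - 1 / (pi * t)) * (1 / t powr (\<nu> + 1)))
       \<and> (\<lambda>k. let n = real (Suc k) in
              1 / n powr (\<nu> + 1) * (bessel_I \<nu> (n * x) - struve_L \<nu> (n * x)))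
           sums
         (LBINT t:{0<..}. bessel_J \<nu> (x * t) * (coth (pi * t) - 1 / (pi * t)) * (1 / t powr (\<nu> + 1)))"
proof -
  have \<nu>: "\<nu> > - 1 / 2" using assms by simp
  define K where "K = (\<lambda>y. \<integral>w. cos (y * sqrt w) \<partial>beta_measure \<nu>)"
  define A where "A = (x / 2) powr \<nu> / (sqrt pi * Gamma (\<nu> + 1 / 2))"
  \<comment> \<open>\<open>F k\<close> is the integrand with the \<open>k\<close>-th partial
    fraction in place of the bracket: \<open>t powr \<nu>\<close> from the Bessel function and the
    \<open>t\<close> of the fraction cancel \<open>t powr (\<nu> + 1)\<close>.\<close>
  define F where "F = (\<lambda>k t. A * (2 / pi) * (indicator {0<..} t * (K (x * t) / (t\<^sup>2 + (real (Suc k))\<^sup>2))))"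
  define S where "S = (\<lambda>t. bessel_J \<nu> (x * t) * (coth (pi * t) - 1 / (pi * t)) * (1 / t powr (\<nu> + 1)))"
  \<comment> \<open>\<open>2 / pi\<close> cancels against \<open>pi / (2 * n)\<close>, and on the
    other side \<open>n powr \<nu>\<close> cancels, so both reduce to
    \<open>A * E / n\<close>.\<close>
  have F: "has_bochner_integral lborel (F k)
      (let n = real (Suc k) in 1 / n powr (\<nu> + 1) * (bessel_I \<nu> (n * x) - struve_L \<nu> (n * x)))" for k
  proof -
    define n where "n = real (Suc k)"
    have n: "n > 0" by (simp add: n_def)
    define E where "E = (\<integral>w. exp (- (n * x * sqrt w)) \<partial>beta_measure \<nu>)"
    have "(n * x / 2) powr \<nu> = n powr \<nu> * (x / 2) powr \<nu>"
      using n assms powr_mult[of n "x / 2" \<nu>] by simp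
    hence "1 / n powr (\<nu> + 1) * (bessel_I \<nu> (n * x) - struve_L \<nu> (n * x)) = A * E / n"
      using n assms by (simp add: bessel_I_minus_struve_L_conv_beta_integral[OF \<nu>] A_def E_def powr_add)
    moreover have "A * (2 / pi) * (pi / (2 * n) * E) = A * E / n" by simp
    moreover have "has_bochner_integral lborel (F k) (A * (2 / pi) * (pi / (2 * n) * E))"
      unfolding F_def E_def K_def n_def
      by (intro has_bochner_integral_mult_right beta_integral_cos_over_square_plus_square \<nu> assms) simp
    ultimately show ?thesis unfolding Let_def n_def[symmetric] by (simp only:)
  qed
  \<comment> \<open>For positive \<open>t\<close> the partial fractions are nonnegative, so their
    convergence is absolute; elsewhere everything is 0.\<close>
  have F_sums: "(\<lambda>k. F k t) sums (indicator {0<..} t * S t)" and F_abs: "summable (\<lambda>k. norm (F k t))" for t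
  proof -
    have "(\<lambda>k. F k t) sums (indicator {0<..} t * S t) \<and> summable (\<lambda>k. norm (F k t))"
    proof (cases "t > 0")
      case True
      have "(x * t / 2) powr \<nu> = (x / 2) powr \<nu> * t powr \<nu>"
        using True assms powr_mult[of "x / 2" t \<nu>] by simp
      hence S: "S t = A * K (x * t) / t * (coth (pi * t) - 1 / (pi * t))"
        using True assms
        by (simp add: S_def bessel_J_conv_beta_integral[OF \<nu>] A_def K_def powr_add mult_ac)
      note c = coth_partial_fractions[OF True]
      have F_eq: "F k t = A * K (x * t) / t * (2 * t / pi * (1 / (t\<^sup>2 + (real (Suc k))\<^sup>2)))" for k
        using True by (simp add: F_def)
      have "2 * t / pi * (1 / (t\<^sup>2 + (real (Suc k))\<^sup>2)) \<ge> 0" for k using True by simp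
      hence nF: "norm (F k t) = \<bar>A * K (x * t) / t\<bar> * (2 * t / pi * (1 / (t\<^sup>2 + (real (Suc k))\<^sup>2)))" for k
        unfolding F_eq by (simp only: real_norm_def abs_mult[of "A * K (x * t) / t"] abs_of_nonneg)
      have "summable (\<lambda>k. norm (F k t))"
        unfolding nF by (rule summable_mult[OF sums_summable[OF c]])
      moreover have "(\<lambda>k. F k t) sums (indicator {0<..} t * S t)"
        using sums_mult[OF c, of "A * K (x * t) / t"] True by (simp only: F_eq S) simp
      ultimately show ?thesis by simp
    qed (simp add: F_def)
    thus "(\<lambda>k. F k t) sums (indicator {0<..} t * S t)" "summable (\<lambda>k. norm (F k t))" by auto
  qed
  \<comment> \<open>Bounding \<open>K\<close> by a constant would give only order
    \<open>1 / n\<close>, which diverges. The decay of \<open>K\<close> and the scaling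
    \<open>t = n * s\<close> supply an extra \<open>n powr (- 1 / 2)\<close>, hence the summable
    \<open>n powr (- 3 / 2)\<close>.\<close>
  have F_norm: "summable (\<lambda>k. \<integral>t. norm (F k t) \<partial>lborel)"
  proof -
    obtain C where C: "C \<ge> 0" "\<And>y. y > 0 \<Longrightarrow> \<bar>K y\<bar> \<le> C * y powr (- 1 / 2)"
      unfolding K_def using beta_integral_decay[OF assms(1)] by metis
    define I where "I = (\<integral>s. indicator {0<..} s * (s powr (- 1 / 2) / (1 + s\<^sup>2)) \<partial>(lborel :: real measure))"
    have I: "has_bochner_integral lborel (\<lambda>s::real. indicator {0<..} s * (s powr (- 1 / 2) / (1 + s\<^sup>2))) I"
      using inverse_sqrt_over_one_plus_square_integrable by (simp add: I_def has_bochner_integral_iff)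
    define D where "D = \<bar>A * (2 / pi)\<bar> * C * x powr (- 1 / 2)"
    have bound: "(\<integral>t. norm (F k t) \<partial>lborel) \<le> D * I * real (Suc k) powr (- 3 / 2)" for k
    proof -
      define n where "n = real (Suc k)"
      have n: "n > 0" by (simp add: n_def)
      let ?G = "\<lambda>t. D * n powr (- 1 / 2) * (indicator {0<..} t * ((t / n) powr (- 1 / 2) / (t\<^sup>2 + n\<^sup>2)))"
      have G: "has_bochner_integral lborel ?G (D * n powr (- 1 / 2) * (I / n))"
        by (intro has_bochner_integral_mult_right scale_half_line_integral I n)
      have "(\<integral>t. norm (F k t) \<partial>lborel) \<le> (\<integral>t. ?G t \<partial>lborel)"
      proof (rule integral_mono)
        show "integrable lborel (\<lambda>t. norm (F k t))" using F by (intro integrable_norm integrable.intros)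
        show "integrable lborel ?G" using G by (rule integrable.intros)
        fix t :: real
        show "norm (F k t) \<le> ?G t"
        proof (cases "t > 0")
          case True
          \<comment> \<open>Factoring \<open>x * t\<close> this way exposes \<open>t / n\<close>,
            the argument in the scaled integral.\<close>
          have "(x * (n * (t / n))) powr (- 1 / 2) =
              x powr (- 1 / 2) * (n powr (- 1 / 2) * (t / n) powr (- 1 / 2))"
            using True n assms by (simp only: powr_mult)
          hence p: "x powr (- 1 / 2) * (n powr (- 1 / 2) * (t / n) powr (- 1 / 2)) = (x * t) powr (- 1 / 2)"
            using n by simp
          have "norm (F k t) = \<bar>A * (2 / pi)\<bar> * (\<bar>K (x * t)\<bar> / (t\<^sup>2 + n\<^sup>2))"
            using True by (simp add: F_def abs_mult n_def)
          also have "\<dots> \<le> \<bar>A * (2 / pi)\<bar> * ((C * (x * t) powr (- 1 / 2)) / (t\<^sup>2 + n\<^sup>2))"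
            using True assms by (intro mult_left_mono divide_right_mono C) auto
          also have "\<dots> = ?G t" using True unfolding p[symmetric] D_def by simp
          finally show ?thesis .
        qed (simp add: F_def)
      qed
      also have "(\<integral>t. ?G t \<partial>lborel) = D * n powr (- 1 / 2) * (I / n)"
        using G by (simp only: has_bochner_integral_iff)
      also have "\<dots> = D * I * n powr (- 3 / 2)"
        using n powr_diff[of n "- 1 / 2" 1] by simp
      finally show ?thesis by (simp only: n_def)
    qed
    have "summable (\<lambda>k. real (Suc k) powr (- 3 / 2))"
      by (subst summable_Suc_iff) (simp add: summable_real_powr_iff)
    hence "summable (\<lambda>k. D * I * real (Suc k) powr (- 3 / 2))" by (rule summable_mult)
    thus ?thesis
    proof (rule summable_comparison_test'[where N = 0])
      fix k
      show "norm (\<integral>t. norm (F k t) \<partial>lborel) \<le> D * I * real (Suc k) powr (- 3 / 2)"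
        using bound[of k] by (simp only: real_norm_def abs_of_nonneg[OF integral_nonneg_AE[OF AE_I2]] abs_ge_zero)
    qed
  qed
  have suminf: "(\<lambda>t. \<Sum>k. F k t) = (\<lambda>t. indicator {0<..} t * S t)"
    using F_sums by (simp add: sums_iff)
  have F_int: "integrable lborel (F k)" for k using F by (rule integrable.intros)
  have "integrable lborel (\<lambda>t. \<Sum>k. F k t)"
    by (rule integrable_suminf[OF F_int AE_I2[OF F_abs] F_norm])
  moreover have "(\<lambda>k. integral\<^sup>L lborel (F k)) sums (\<integral>t. (\<Sum>k. F k t) \<partial>lborel)"
    by (rule sums_integral[OF F_int AE_I2[OF F_abs] F_norm])
  moreover have "integral\<^sup>L lborel (F k) =
      (let n = real (Suc k) in 1 / n powr (\<nu> + 1) * (bessel_I \<nu> (n * x) - struve_L \<nu> (n * x)))" for k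
    using F[of k] by (simp only: has_bochner_integral_iff)
  ultimately show ?thesis
    unfolding suminf set_integrable_def set_lebesgue_integral_def S_def real_scaleR_def by (simp only: simp_thms)
qed

end
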